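(* Let $\mathcal{K}$ be an algebraically closed field, let $f_1,\dots,f_L\in\mathcal{K}[x_1,\dots,x_S]$ be algebraically independent over $\mathcal{K}$, and let $c_1,\dots,c_L$ be independent random variables drawn from continuous distributions in $\mathcal{K}$. Then the polynomials $g_i=c_i+f_i$, $i\in\{1,\dots,L\}$, are algebraically independent over $\mathcal{K}$ almost surely.
   Context: Polynomials $f_1,\dots,f_L$ are algebraically independent over $\mathcal{K}$ if there is no nonzero polynomial $p$ in $L$ variables with coefficients in $\mathcal{K}$ such that $p(f_1,\dots,f_L)=0$. *)

theory Defs
  imports "HOL-Probability.Probability" "HOL-Computational_Algebra.Polynomial"
    "HOL-Library.Poly_Mapping"
begin

text \<open>
  Polynomials in variables \<open>x\<^sub>i\<close> (\<open>i :: nat\<close>) are finitely supported maps from exponent vectors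
  \<open>nat \<Rightarrow>\<^sub>0 nat\<close> to coefficients, with the ring structure of \<^theory>\<open>HOL-Library.Poly_Mapping\<close>.
  The polynomial ring in the variables indexed by \<open>I\<close> is the subset \<open>mpoly_ring I\<close>, so the number
  of variables is an ordinary natural number.
\<close>

type_synonym 'a mpoly = "(nat \<Rightarrow>\<^sub>0 nat) \<Rightarrow>\<^sub>0 'a"

definition mpoly_ring :: "nat set \<Rightarrow> 'a::zero mpoly set" where
  "mpoly_ring I = {p. \<forall>m\<in>Poly_Mapping.keys p. Poly_Mapping.keys m \<subseteq> I}"

definition mpoly_const :: "'a::zero \<Rightarrow> 'a mpoly" where
  "mpoly_const a = Poly_Mapping.single 0 a"

text \<open>The polynomial \<open>p(f\<^sub>1, f\<^sub>2, \<dots>)\<close> obtained by substituting \<open>f i\<close> for the variable \<open>x\<^sub>i\<close> in \<open>p\<close>.\<close>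

definition mpoly_subst :: "(nat \<Rightarrow> 'a mpoly) \<Rightarrow> 'a::comm_ring_1 mpoly \<Rightarrow> 'a mpoly" where
  "mpoly_subst f p =
     (\<Sum>m\<in>Poly_Mapping.keys p. mpoly_const (Poly_Mapping.lookup p m) *
        (\<Prod>i\<in>Poly_Mapping.keys m. f i ^ Poly_Mapping.lookup m i))"

definition alg_independent :: "nat \<Rightarrow> (nat \<Rightarrow> 'a::field mpoly) \<Rightarrow> bool" where
  "alg_independent L f \<longleftrightarrow> \<not> (\<exists>p\<in>mpoly_ring {1..L}. p \<noteq> 0 \<and> mpoly_subst f p = 0)"

text \<open>
  A general field carries no canonical reference measure, so ``continuous'' is taken in the weakest
  standard sense: every point has probability zero. For the Borel sets of the complex numbers this
  includes all distributions having a density.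
\<close>

definition continuous_distribution :: "'a measure \<Rightarrow> bool" where
  "continuous_distribution D \<longleftrightarrow>
     prob_space D \<and> (\<forall>x\<in>space D. {x} \<in> sets D \<and> measure D {x} = 0)"

end

theory Submission
  imports Defs
begin

text \<open>
  For arbitrary constants \<open>a\<^sub>i\<close>, the substitution \<open>x\<^sub>i \<mapsto> a\<^sub>i + x\<^sub>i\<close> is an automorphism of the
  polynomial ring with inverse \<open>x\<^sub>i \<mapsto> -a\<^sub>i + x\<^sub>i\<close>. It turns a relation \<open>p\<close> among the \<open>a\<^sub>i + f\<^sub>i\<close>
  into a relation among the \<open>f\<^sub>i\<close>, which vanishes only if \<open>p\<close> does. So the shifted family is
  algebraically independent at every sample point, whatever the distribution of the constants.
\<close>

text \<open>The additional factors are \<open>g i ^ 0 = 1\<close>. This lets products over different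
  supports be compared over one common index set.\<close>

lemma prod_keys_superset:
  fixes g :: "'k \<Rightarrow> 'b::comm_monoid_mult"
  assumes "finite A" "Poly_Mapping.keys m \<subseteq> A"
  shows "(\<Prod>i\<in>Poly_Mapping.keys m. g i ^ Poly_Mapping.lookup m i) =
    (\<Prod>i\<in>A. g i ^ Poly_Mapping.lookup m i)"
  by (rule prod.mono_neutral_left) (use assms in \<open>auto simp: in_keys_iff\<close>)

lemma prod_keys_add:
  fixes g :: "'k \<Rightarrow> 'b::comm_monoid_mult"
  shows "(\<Prod>i\<in>Poly_Mapping.keys (m + n). g i ^ Poly_Mapping.lookup (m + n) i) =
    (\<Prod>i\<in>Poly_Mapping.keys m. g i ^ Poly_Mapping.lookup m i) *
    (\<Prod>i\<in>Poly_Mapping.keys n. g i ^ Poly_Mapping.lookup n i)"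
proof -
  let ?A = "Poly_Mapping.keys m \<union> Poly_Mapping.keys n"
  show ?thesis
    using prod_keys_superset[of ?A m g] prod_keys_superset[of ?A n g]
      prod_keys_superset[of ?A "m + n" g] Poly_Mapping.keys_add[of m n]
    by (simp add: lookup_add power_add prod.distrib)
qed

lemma mpoly_const_0 [simp]: "mpoly_const 0 = 0"
  by (simp add: mpoly_const_def)

lemma mpoly_const_1 [simp]: "mpoly_const 1 = 1"
  by (simp add: mpoly_const_def)

lemma mpoly_const_add: "mpoly_const (a + b) = mpoly_const a + mpoly_const b"
  by (simp add: mpoly_const_def single_add)

lemma mpoly_const_mult:
  "mpoly_const (a * b) = mpoly_const a * (mpoly_const b :: 'a::comm_ring_1 mpoly)"
  by (simp add: mpoly_const_def mult_single)

text \<open>Additional monomials contribute zero coefficients, so sums for different polynomials can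
  share an index set.\<close>

lemma mpoly_subst_superset:
  assumes "finite A" "Poly_Mapping.keys p \<subseteq> A"
  shows "mpoly_subst g p =
     (\<Sum>m\<in>A. mpoly_const (Poly_Mapping.lookup p m) *
        (\<Prod>i\<in>Poly_Mapping.keys m. g i ^ Poly_Mapping.lookup m i))"
  unfolding mpoly_subst_def
  by (rule sum.mono_neutral_left) (use assms in \<open>auto simp: in_keys_iff\<close>)

lemma mpoly_subst_single:
  "mpoly_subst g (Poly_Mapping.single m a) =
     mpoly_const a * (\<Prod>i\<in>Poly_Mapping.keys m. g i ^ Poly_Mapping.lookup m i)"
  by (simp add: mpoly_subst_superset[of "{m}"])

lemma mpoly_subst_0 [simp]: "mpoly_subst g 0 = 0"
  by (simp add: mpoly_subst_def)

lemma mpoly_subst_const [simp]: "mpoly_subst g (mpoly_const a) = mpoly_const a"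
  unfolding mpoly_const_def[of a] by (simp add: mpoly_subst_single) (simp add: mpoly_const_def)

lemma mpoly_subst_1 [simp]: "mpoly_subst g 1 = 1"
  using mpoly_subst_const[of g 1] by simp

lemma mpoly_subst_add: "mpoly_subst g (p + q) = mpoly_subst g p + mpoly_subst g q"
proof -
  let ?A = "Poly_Mapping.keys p \<union> Poly_Mapping.keys q"
  show ?thesis
    using Poly_Mapping.keys_add[of p q]
    by (simp add: mpoly_subst_superset[of ?A] lookup_add mpoly_const_add distrib_right sum.distrib)
qed

lemma mpoly_subst_sum: "mpoly_subst g (\<Sum>i\<in>A. p i) = (\<Sum>i\<in>A. mpoly_subst g (p i))"
  by (induction A rule: infinite_finite_induct) (auto simp: mpoly_subst_add)

lemma mpoly_monomial_expansion:
  "p = (\<Sum>m\<in>Poly_Mapping.keys p. Poly_Mapping.single m (Poly_Mapping.lookup p m))"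
  by (rule poly_mapping_eqI)
    (auto simp: lookup_sum lookup_single when_def in_keys_iff sum.delta)

text \<open>By distributivity it suffices to treat products of two monomials; there coefficients
  multiply and, by \<open>prod_keys_add\<close>, adding exponent vectors multiplies the substituted
  values.\<close>

lemma mpoly_subst_mult:
  fixes p q :: "'a::comm_ring_1 mpoly"
  shows "mpoly_subst g (p * q) = mpoly_subst g p * mpoly_subst g q"
proof -
  have "mpoly_subst g (p * q) = mpoly_subst g
    ((\<Sum>m\<in>Poly_Mapping.keys p. Poly_Mapping.single m (Poly_Mapping.lookup p m)) *
     (\<Sum>n\<in>Poly_Mapping.keys q. Poly_Mapping.single n (Poly_Mapping.lookup q n)))"
    using mpoly_monomial_expansion[of p] mpoly_monomial_expansion[of q] by simp
  also have "\<dots> = mpoly_subst g p * mpoly_subst g q"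
    unfolding sum_product mult_single mpoly_subst_sum mpoly_subst_single mpoly_const_mult
      prod_keys_add mpoly_subst_def[of g p] mpoly_subst_def[of g q]
    by (simp add: ac_simps)
  finally show ?thesis .
qed

lemma mpoly_subst_power: "mpoly_subst g (p ^ n) = mpoly_subst g p ^ n"
  by (induction n) (auto simp: mpoly_subst_mult)

lemma mpoly_subst_prod: "mpoly_subst g (\<Prod>i\<in>A. p i) = (\<Prod>i\<in>A. mpoly_subst g (p i))"
  by (induction A rule: infinite_finite_induct) (auto simp: mpoly_subst_mult)

text \<open>The outer substitution is a ring homomorphism fixing constants, so it passes through
  every sum, product and power down to the images \<open>h i\<close> of the variables.\<close>

lemma mpoly_subst_subst: "mpoly_subst g (mpoly_subst h p) = mpoly_subst (\<lambda>i. mpoly_subst g (h i)) p"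
  unfolding mpoly_subst_def[of h] mpoly_subst_def[of "\<lambda>i. mpoly_subst g (h i)"]
  by (simp add: mpoly_subst_sum mpoly_subst_mult mpoly_subst_prod mpoly_subst_power)

definition mpoly_var :: "nat \<Rightarrow> 'a::comm_ring_1 mpoly" where
  "mpoly_var i = Poly_Mapping.single (Poly_Mapping.single i 1) 1"

lemma mpoly_subst_var [simp]: "mpoly_subst g (mpoly_var i) = g i"
  by (simp add: mpoly_var_def mpoly_subst_single)

lemma mpoly_var_power:
  "mpoly_var i ^ n = Poly_Mapping.single (Poly_Mapping.single i n) 1"
  by (induction n) (auto simp: mpoly_var_def mult_single single_add[symmetric])

text \<open>Multiplying monomials adds their exponent vectors. For infinite \<open>A\<close> both
  sides are 1, by the default values of the empty sum and product.\<close>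

lemma prod_mpoly_var_power:
  "(\<Prod>i\<in>A. mpoly_var i ^ e i) = Poly_Mapping.single (\<Sum>i\<in>A. Poly_Mapping.single i (e i)) 1"
  by (induction A rule: infinite_finite_induct) (auto simp: mpoly_var_power mult_single)

lemma exponent_expansion:
  fixes m :: "nat \<Rightarrow>\<^sub>0 nat"
  shows "(\<Sum>i\<in>Poly_Mapping.keys m. Poly_Mapping.single i (Poly_Mapping.lookup m i)) = m"
  by (rule poly_mapping_eqI)
    (auto simp: lookup_sum lookup_single when_def in_keys_iff sum.delta)

text \<open>Each monomial is reassembled from its variables, and the polynomial from its monomials.
  This is what makes mutually inverse substitutions detectable through
  \<open>mpoly_subst_subst\<close>.\<close>

lemma mpoly_subst_id: "mpoly_subst mpoly_var p = p"
  unfolding mpoly_subst_def prod_mpoly_var_power exponent_expansion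
  by (subst (3) mpoly_monomial_expansion) (simp add: mpoly_const_def mult_single)

lemma mpoly_ring_0: "0 \<in> mpoly_ring I"
  by (simp add: mpoly_ring_def)

lemma mpoly_const_in_ring: "mpoly_const a \<in> mpoly_ring I"
  by (simp add: mpoly_ring_def mpoly_const_def)

lemma mpoly_ring_1: "(1 :: 'a::comm_ring_1 mpoly) \<in> mpoly_ring I"
  using mpoly_const_in_ring[of "1::'a"] by simp

lemma mpoly_var_in_ring: "i \<in> I \<Longrightarrow> mpoly_var i \<in> mpoly_ring I"
  by (simp add: mpoly_ring_def mpoly_var_def)

lemma mpoly_ring_add: "p \<in> mpoly_ring I \<Longrightarrow> q \<in> mpoly_ring I \<Longrightarrow> p + q \<in> mpoly_ring I"
  using Poly_Mapping.keys_add[of p q] unfolding mpoly_ring_def by blast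

lemma mpoly_ring_mult:
  fixes p q :: "'a::comm_ring_1 mpoly"
  assumes "p \<in> mpoly_ring I" "q \<in> mpoly_ring I"
  shows "p * q \<in> mpoly_ring I"
  unfolding mpoly_ring_def
proof (intro CollectI ballI)
  fix k assume "k \<in> Poly_Mapping.keys (p * q)"
  then obtain m n where "k = m + n" "m \<in> Poly_Mapping.keys p" "n \<in> Poly_Mapping.keys q"
    using keys_mult[of p q] by blast
  then show "Poly_Mapping.keys k \<subseteq> I"
    using assms Poly_Mapping.keys_add[of m n] unfolding mpoly_ring_def by blast
qed

lemma mpoly_ring_power:
  "(p :: 'a::comm_ring_1 mpoly) \<in> mpoly_ring I \<Longrightarrow> p ^ n \<in> mpoly_ring I"
  by (induction n) (auto intro: mpoly_ring_mult mpoly_ring_1)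

lemma mpoly_ring_sum: "(\<And>i. i \<in> A \<Longrightarrow> p i \<in> mpoly_ring I) \<Longrightarrow> (\<Sum>i\<in>A. p i) \<in> mpoly_ring I"
  by (induction A rule: infinite_finite_induct) (auto intro: mpoly_ring_add mpoly_ring_0)

lemma mpoly_ring_prod:
  fixes p :: "nat \<Rightarrow> 'a::comm_ring_1 mpoly"
  shows "(\<And>i. i \<in> A \<Longrightarrow> p i \<in> mpoly_ring I) \<Longrightarrow> (\<Prod>i\<in>A. p i) \<in> mpoly_ring I"
  by (induction A rule: infinite_finite_induct) (auto intro: mpoly_ring_mult mpoly_ring_1)

text \<open>Needed so that a transformed relation still involves only the permitted variables; it
  follows from closure of \<open>mpoly_ring I\<close> under the ring operations.\<close>

lemma mpoly_subst_in_ring: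
  assumes "p \<in> mpoly_ring J" "\<And>i. i \<in> J \<Longrightarrow> g i \<in> mpoly_ring I"
  shows "mpoly_subst g p \<in> mpoly_ring I"
  unfolding mpoly_subst_def
  by (intro mpoly_ring_sum mpoly_ring_mult mpoly_ring_prod mpoly_ring_power mpoly_const_in_ring
      assms(2)) (use assms(1) in \<open>auto simp: mpoly_ring_def\<close>)

lemma alg_independent_shift:
  assumes "alg_independent L f"
  shows "alg_independent L (\<lambda>i. mpoly_const (a i) + f i)"
  unfolding alg_independent_def
proof (intro notI, elim bexE conjE)
  fix p :: "'a mpoly"
  assume p: "p \<in> mpoly_ring {1..L}" "p \<noteq> 0"
    and rel: "mpoly_subst (\<lambda>i. mpoly_const (a i) + f i) p = 0"
  define q where "q = mpoly_subst (\<lambda>i. mpoly_const (a i) + mpoly_var i) p"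
  have "mpoly_subst (\<lambda>i. mpoly_const (- a i) + mpoly_var i) q = mpoly_subst mpoly_var p"
    unfolding q_def mpoly_subst_subst
    \<comment> \<open>Regrouping puts the constants \<open>a i\<close> and \<open>- a i\<close> side
      by side, where they cancel.\<close>
    by (simp add: mpoly_subst_add add.assoc[symmetric] mpoly_const_add[symmetric])
  then have "q \<noteq> 0"
    using p(2) by (auto simp: mpoly_subst_id)
  moreover have "q \<in> mpoly_ring {1..L}"
    unfolding q_def using p(1)
    by (rule mpoly_subst_in_ring) (intro mpoly_ring_add mpoly_const_in_ring mpoly_var_in_ring)
  \<comment> \<open>Composing the translation with \<open>f\<close> sends the variable of index
    \<open>i\<close> to \<open>mpoly_const (a i) + f i\<close>, so this is exactly
    \<open>rel\<close>.\<close>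
  moreover have "mpoly_subst f q = 0"
    unfolding q_def mpoly_subst_subst using rel by (simp add: mpoly_subst_add)
  ultimately show False
    using assms unfolding alg_independent_def by blast
qed

theorem mainTheorem8:
  fixes L S :: nat
    and f :: "nat \<Rightarrow> 'a::alg_closed_field mpoly"
    and M :: "'w measure"
    and N :: "'a measure"
    and c :: "nat \<Rightarrow> 'w \<Rightarrow> 'a"
  assumes "\<And>i. i \<in> {1..L} \<Longrightarrow> f i \<in> mpoly_ring {1..S}"
    and "alg_independent L f"
    and "prob_space M"
    and "space N = UNIV"
    and "prob_space.indep_vars M (\<lambda>_. N) c {1..L}"
    and "\<And>i. i \<in> {1..L} \<Longrightarrow> continuous_distribution (distr M N (c i))"
  shows "AE w in M. alg_independent L (\<lambda>i. mpoly_const (c i w) + f i)"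
  \<comment> \<open>For each fixed \<open>w\<close> the shift is by the constants
    \<open>a i = c i w\<close>, so the property holds pointwise on all of \<open>M\<close>.\<close>
  using alg_independent_shift[OF assms(2)] by simp

end
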